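(* Let $E$ be a Banach space, $\Lambda\subset E$ an open set, $\mathcal{F}=\{M(x)\}_{x\in\Lambda}$ a family of subspaces $M(x)\subset E$ (possibly infinite-dimensional), and $x_0\in\Lambda$. If $\mathcal{F}$ is $C^1$ integrable at $x_0$ and $S\subset E$ is an integral submanifold of $\mathcal{F}$ at $x_0$, then there exist a closed subspace $E_*\subset E$ and a neighborhood $U_0$ of $x_0$ such that $$M(x)\oplus E_*=E\qquad\text{for all } x\in S\cap U_0,$$ i.e., $J(x_0,E_* )\supset S\cap U_0$.
   Context: Direct sums: $E=A\oplus B$ means that $A,B$ are closed subspaces of $E$ with $A+B=E$ and $A\cap B=\{0\}$. A subspace $A$ splits in $E$ if it is closed and $E=A\oplus B$ for some closed $B$. $C^1$ submanifold: a subset $S\subset E$ is a $C^1$ submanifold if for each $p\in S$ there are a subspace $E_0$ splitting in $E$, an open neighborhood $U_0$ of $p$ in $E$, and a $C^1$ diffeomorphism $\varphi:U_0\to\varphi(U_0)$ onto an open subset of $E$, such that $\varphi(S\cap U_0)$ is an open set in $E_0$. Tangency: $S$ is tangent to $M(x)$ at $x\in S$ if $M(x)=\{\dot c(0): c \text{ a } C^1\text{-curve},\ c(t)\in S,\ c(0)=x\}$. Integrability: $\mathcal{F}$ is $C^1$ integrable at $x_0\in\Lambda$ if there is a $C^1$ submanifold $S\subset\Lambda$ of $E$ with $x_0\in S$ which is tangent to $M(x)$ at every $x\in S$; such an $S$ is called an integral submanifold of $\mathcal{F}$ at $x_0$. Co-final set: for a closed subspace $E_*$ with $E=M(x_0)\oplus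 E_*$, the co-final set of $\mathcal{F}$ at $x_0$ is $J(x_0,E_* )=\{x\in\Lambda: M(x)\oplus E_*=E\}$. *)

theory Defs
  imports "HOL-Analysis.Analysis"
begin

(* E = A \<oplus> B, where E is the whole type. *)
definition is_direct_sum :: "'a::real_normed_vector set \<Rightarrow> 'a set \<Rightarrow> bool" where
  "is_direct_sum A B \<longleftrightarrow>
     subspace A \<and> closed A \<and> subspace B \<and> closed B \<and>
     {a + b | a b. a \<in> A \<and> b \<in> B} = UNIV \<and> A \<inter> B = {0}"

definition splits :: "'a::real_normed_vector set \<Rightarrow> bool" where
  "splits A \<longleftrightarrow> subspace A \<and> closed A \<and> (\<exists>B. is_direct_sum A B)"

(* Frechet differentiable with derivative continuous in operator norm; meant for open U. *)
definition C1_map_on ::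
    "('a::real_normed_vector \<Rightarrow> 'b::real_normed_vector) \<Rightarrow> 'a set \<Rightarrow> bool" where
  "C1_map_on f U \<longleftrightarrow>
     (\<exists>f' :: 'a \<Rightarrow> 'a \<Rightarrow>\<^sub>L 'b.
        (\<forall>x\<in>U. (f has_derivative blinfun_apply (f' x)) (at x)) \<and> continuous_on U f')"

definition C1_diffeomorphism ::
    "('a::real_normed_vector \<Rightarrow> 'b::real_normed_vector) \<Rightarrow> 'a set \<Rightarrow> 'b set \<Rightarrow> bool" where
  "C1_diffeomorphism \<phi> U V \<longleftrightarrow>
     open U \<and> open V \<and> bij_betw \<phi> U V \<and> C1_map_on \<phi> U \<and> C1_map_on (inv_into U \<phi>) V"

(* The model space E0 may depend on the point p. *)
definition C1_submanifold :: "'a::real_normed_vector set \<Rightarrow> bool" where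
  "C1_submanifold S \<longleftrightarrow>
     (\<forall>p\<in>S. \<exists>(E0 :: 'a set) U0 (\<phi> :: 'a \<Rightarrow> 'a).
        splits E0 \<and> open U0 \<and> p \<in> U0 \<and> C1_diffeomorphism \<phi> U0 (\<phi> ` U0) \<and>
        openin (top_of_set E0) (\<phi> ` (S \<inter> U0)))"

(* Curves are defined on some open interval around 0; values of c outside it are irrelevant. *)
definition tangent_vectors :: "'a::real_normed_vector set \<Rightarrow> 'a \<Rightarrow> 'a set" where
  "tangent_vectors S x =
     {v. \<exists>\<epsilon>>0. \<exists>c :: real \<Rightarrow> 'a.
        c C1_differentiable_on {-\<epsilon><..<\<epsilon>} \<and> (\<forall>t\<in>{-\<epsilon><..<\<epsilon>}. c t \<in> S) \<and> c 0 = x \<and>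
        (c has_vector_derivative v) (at 0)}"

definition tangent_at :: "'a::real_normed_vector set \<Rightarrow> ('a \<Rightarrow> 'a set) \<Rightarrow> 'a \<Rightarrow> bool" where
  "tangent_at S M x \<longleftrightarrow> M x = tangent_vectors S x"

(* A family {M(x)} indexed by x in \<Lambda> is a total function M, used only on \<Lambda>. *)
definition integral_submanifold ::
    "'a::real_normed_vector set \<Rightarrow> ('a \<Rightarrow> 'a set) \<Rightarrow> 'a \<Rightarrow> 'a set \<Rightarrow> bool" where
  "integral_submanifold \<Lambda> M x0 S \<longleftrightarrow>
     C1_submanifold S \<and> S \<subseteq> \<Lambda> \<and> x0 \<in> S \<and> (\<forall>x\<in>S. tangent_at S M x)"

definition C1_integrable_at ::
    "'a::real_normed_vector set \<Rightarrow> ('a \<Rightarrow> 'a set) \<Rightarrow> 'a \<Rightarrow> bool" where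
  "C1_integrable_at \<Lambda> M x0 \<longleftrightarrow> (\<exists>S. integral_submanifold \<Lambda> M x0 S)"

(* J(x0, Es). The base point x0 enters only through the standing requirement that
   is_direct_sum (M x0) Es, which is stated separately wherever the set is used. *)
definition cofinal_set ::
    "'a::real_normed_vector set \<Rightarrow> ('a \<Rightarrow> 'a set) \<Rightarrow> 'a set \<Rightarrow> 'a set" where
  "cofinal_set \<Lambda> M Es = {x \<in> \<Lambda>. is_direct_sum (M x) Es}"

end

theory Submission
  imports Defs
begin

text \<open>
  Let \<open>\<phi>\<close> be a chart of \<open>S\<close> at \<open>x0\<close> with model space \<open>E0\<close> and inverse \<open>\<psi>\<close>. Tangency gives
  \<open>M x = D\<psi>(\<phi> x) E0\<close> for \<open>x\<close> in the chart domain. If \<open>B\<close> is a closed complement of \<open>E0\<close>, put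
  \<open>Es = D\<psi>(\<phi> x0) B\<close>. The projection \<open>P\<close> onto \<open>E0\<close> along \<open>B\<close> is bounded by the closed graph theorem,
  so \<open>D\<psi>(\<phi> x) P + D\<psi>(\<phi> x0) (id - P)\<close> depends continuously on \<open>x\<close> in operator norm and equals the
  isomorphism \<open>D\<psi>(\<phi> x0)\<close> at \<open>x0\<close>. It is therefore an isomorphism near \<open>x0\<close>, and it carries
  \<open>E0 \<oplus> B\<close> to \<open>M x \<oplus> Es\<close>.
\<close>

section \<open>The closed graph theorem\<close>

text \<open>Baire's theorem gives some closed \<open>F n\<close> a ball. By linearity every
  \<open>x\<close> then has, within distance \<open>norm x / 2\<close>, a vector whose image under
  \<open>f\<close> is bounded by a fixed multiple of \<open>norm x\<close>. Iterating this removes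
  the error.\<close>

theorem closed_graph:
  fixes f :: "'a::banach \<Rightarrow> 'b::banach"
  assumes lin: "linear f" and cl: "closed (range (\<lambda>x. (x, f x)))"
  shows "bounded_linear f"
proof -
  interpret f: linear f by fact
  define F where "F n = closure {x. norm (f x) \<le> real n}" for n
  have UnF: "\<Union>(range F) = UNIV"
  proof -
    have "x \<in> F (nat \<lceil>norm (f x)\<rceil>)" for x
      unfolding F_def by (rule subsetD[OF closure_subset]) (simp add: real_nat_ceiling_ge)
    then show ?thesis by blast
  qed
  have "\<exists>n. interior (F n) \<noteq> {}"
  proof (rule ccontr)
    assume "\<nexists>n. interior (F n) \<noteq> {}"
    then have "euclidean interior_of \<Union>(range F) = {}"
      by (intro Baire_category_alt disjI1)
        (auto simp: F_def completely_metrizable_space_euclidean)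
    then show False by (simp add: UnF)
  qed
  then obtain n a r where r: "r > 0" and ball: "ball a r \<subseteq> F n"
    by (metis all_not_in_conv mem_interior)
  \<comment> \<open>By convexity and symmetry the ball can be moved to the origin.\<close>
  have approx0: "\<exists>u. norm (f u) \<le> n \<and> norm (x - u) < e" if xr: "norm x < r" and e0: "e > 0" for x e
  proof -
    have "a + x \<in> F n" "a - x \<in> F n"
      using xr ball by (auto simp: dist_norm subset_iff)
    then obtain u v where "norm (f u) \<le> n" "dist u (a + x) < e" "norm (f v) \<le> n" "dist v (a - x) < e"
      unfolding F_def closure_approachable using e0 by blast
    then have uv: "norm (f u) \<le> n" "norm (f v) \<le> n" "norm (u - (a + x)) < e" "norm (v - (a - x)) < e"
      by (auto simp: dist_norm)
    let ?w = "(1/2) *\<^sub>R (u - v)"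
    have "norm (f ?w) = 1/2 * norm (f u - f v)"
      by (simp add: f.scaleR f.diff)
    also have "\<dots> \<le> n"
      using uv norm_triangle_ineq4[of "f u" "f v"] by simp
    finally have "norm (f ?w) \<le> n" .
    moreover have "norm (x - ?w) < e"
    proof -
      have "x - ?w = (1/2) *\<^sub>R ((v - (a - x)) - (u - (a + x)))"
        by (simp add: algebra_simps flip: scaleR_2)
      then have "norm (x - ?w) = 1/2 * norm ((v - (a - x)) - (u - (a + x)))"
        by simp
      then show ?thesis
        using uv norm_triangle_ineq4[of "v - (a - x)" "u - (a + x)"] by simp
    qed
    ultimately show ?thesis by blast
  qed
  \<comment> \<open>A nonzero \<open>x\<close> is rescaled below to norm \<open>r / 2\<close>,
    inside the ball where the approximation holds; undoing the scaling turns the bound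
    \<open>n\<close> into \<open>C * norm x\<close>.\<close>
  define C where "C = 2 * real n / r"
  have C0: "C \<ge> 0" using r by (simp add: C_def)
  have "\<exists>u. norm (f u) \<le> C * norm x \<and> norm (x - u) \<le> norm x / 2" for x
  proof (cases "x = 0")
    case True
    then show ?thesis by (intro exI[of _ 0]) (simp add: f.zero)
  next
    case False
    define c where "c = r / (2 * norm x)"
    have c: "c > 0" using r False by (simp add: c_def)
    have "norm (c *\<^sub>R x) < r" using r False by (simp add: c_def)
    moreover have "c * norm x / 2 > 0" using c False by simp
    ultimately obtain u where u: "norm (f u) \<le> n" "norm (c *\<^sub>R x - u) < c * norm x / 2"
      using approx0 by blast
    let ?w = "(1/c) *\<^sub>R u"
    have "norm (f ?w) = norm (f u) / c" using c by (simp add: f.scaleR)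
    also have "\<dots> \<le> n / c" using u c by (simp add: divide_right_mono)
    also have "\<dots> = C * norm x" using r False by (simp add: c_def C_def field_simps)
    finally have 1: "norm (f ?w) \<le> C * norm x" .
    have "x - ?w = (1/c) *\<^sub>R (c *\<^sub>R x - u)" using c by (simp add: algebra_simps)
    then have "norm (x - ?w) = norm (c *\<^sub>R x - u) / c" using c by simp
    also have "\<dots> \<le> norm x / 2" using u c by (simp add: field_simps)
    finally show ?thesis using 1 by blast
  qed
  then obtain g where g: "\<And>x. norm (f (g x)) \<le> C * norm x" "\<And>x. norm (x - g x) \<le> norm x / 2"
    by metis
  \<comment> \<open>Successive approximation: \<open>x\<close> is the sum of the corrections \<open>g (X k)\<close>, whose images under
    \<open>f\<close> decay geometrically; the closed graph identifies the sum of the images with \<open>f x\<close>.\<close>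
  have bound: "norm (f x) \<le> norm x * (2 * C)" for x
  proof -
    define X where "X k = ((\<lambda>z. z - g z) ^^ k) x" for k
    have X0: "X 0 = x" and XS: "X (Suc k) = X k - g (X k)" for k
      by (simp_all add: X_def)
    have nX: "norm (X k) \<le> norm x * (1/2)^k" for k
    proof (induction k)
      case (Suc k)
      then show ?case using g(2)[of "X k"] by (simp add: XS)
    qed (simp add: X0)
    have sumg: "(\<Sum>k<m. g (X k)) = x - X m" for m
      by (induction m) (simp_all add: X0 XS)
    have "(\<lambda>m. norm x * (1/2)^m) \<longlonglongrightarrow> norm x * 0"
      by (intro tendsto_intros LIMSEQ_power_zero) simp
    then have "X \<longlonglongrightarrow> 0"
      using nX by (intro Lim_null_comparison[of X "\<lambda>m. norm x * (1/2)^m"]) auto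
    then have lim: "(\<lambda>m. x - X m) \<longlonglongrightarrow> x"
      using tendsto_diff[of "\<lambda>_. x"] by fastforce
    have nfg: "norm (f (g (X k))) \<le> C * norm x * (1/2)^k" for k
      using order_trans[OF g(1) mult_left_mono[OF nX C0]] by (simp add: mult.assoc)
    have geo: "(\<lambda>k. C * norm x * (1/2::real)^k) sums (C * norm x * 2)"
      using sums_mult[OF geometric_sums[of "1/2::real"], of "C * norm x"] by simp
    have sn: "summable (\<lambda>k. norm (f (g (X k))))"
      using nfg by (intro summable_comparison_test'[OF sums_summable[OF geo], of 0]) simp
    then have "(\<lambda>m. \<Sum>k<m. f (g (X k))) \<longlonglongrightarrow> (\<Sum>k. f (g (X k)))"
      by (rule summable_LIMSEQ[OF summable_norm_cancel])
    then have "(\<lambda>m. f (x - X m)) \<longlonglongrightarrow> (\<Sum>k. f (g (X k)))"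
      by (simp flip: sumg add: f.sum)
    with lim have "(\<lambda>m. (x - X m, f (x - X m))) \<longlonglongrightarrow> (x, \<Sum>k. f (g (X k)))"
      by (intro tendsto_Pair)
    then have "(x, \<Sum>k. f (g (X k))) \<in> range (\<lambda>x. (x, f x))"
      by (rule closed_sequentially[OF cl rangeI])
    then have "f x = (\<Sum>k. f (g (X k)))" by auto
    then have "norm (f x) \<le> (\<Sum>k. norm (f (g (X k))))"
      using summable_norm[OF sn] by simp
    also have "\<dots> \<le> C * norm x * 2"
      using suminf_le[OF nfg sn sums_summable[OF geo]] sums_unique[OF geo] by simp
    finally show ?thesis by (simp add: mult_ac)
  qed
  show ?thesis
    using bound by (intro bounded_linear_intro) (auto simp: f.add f.scaleR)
qed

section \<open>Direct sums: bounded projections and stability\<close>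

text \<open>Uniqueness of the decomposition makes \<open>P\<close> linear. Its graph consists of the
  pairs with second entry in \<open>A\<close> and difference of entries in \<open>B\<close>, so it
  is closed because \<open>A\<close> and \<open>B\<close> are.\<close>

lemma is_direct_sum_projection:
  fixes A B :: "'a::banach set"
  assumes ds: "is_direct_sum A B"
  obtains P where "bounded_linear P" "\<And>z. P z \<in> A" "\<And>z. z - P z \<in> B"
    "\<And>a b. a \<in> A \<Longrightarrow> b \<in> B \<Longrightarrow> P (a + b) = a"
proof -
  have A: "subspace A" "closed A" and B: "subspace B" "closed B" and int: "A \<inter> B = {0}"
    and sum: "{a + b | a b. a \<in> A \<and> b \<in> B} = UNIV"
    using ds by (auto simp: is_direct_sum_def)
  have "\<exists>a. a \<in> A \<and> z - a \<in> B" for z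
  proof -
    have "z \<in> {a + b | a b. a \<in> A \<and> b \<in> B}" by (simp add: sum)
    then show ?thesis by force
  qed
  then obtain P where P: "\<And>z. P z \<in> A" "\<And>z. z - P z \<in> B" by metis
  have unique: "P z = a" if "a \<in> A" "z - a \<in> B" for z a
  proof -
    have "P z - a \<in> A" using that P A by (auto intro: subspace_diff)
    moreover have "P z - a \<in> B"
      using subspace_diff[OF B(1) that(2) P(2)[of z]] by simp
    ultimately have "P z - a \<in> {0}" using int by blast
    then show ?thesis by simp
  qed
  have "linear P"
  proof
    fix x y c
    have "(x - P x) + (y - P y) \<in> B" "c *\<^sub>R (x - P x) \<in> B"
      using P B by (simp_all add: subspace_add subspace_scale)
    then have "x + y - (P x + P y) \<in> B" "c *\<^sub>R x - c *\<^sub>R P x \<in> B"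
      by (simp_all add: algebra_simps)
    then show "P (x + y) = P x + P y" "P (c *\<^sub>R x) = c *\<^sub>R P x"
      using P A by (simp_all add: unique subspace_add subspace_scale)
  qed
  moreover have "closed (range (\<lambda>x. (x, P x)))"
  proof -
    have "range (\<lambda>x. (x, P x)) = {p. snd p \<in> A} \<inter> {p. fst p - snd p \<in> B}"
      using P unique by (force simp: image_iff)
    moreover have "closed {p::'a \<times> 'a. snd p \<in> A}"
      using continuous_closed_vimage[OF A(2), of snd] by (simp add: vimage_def isCont_snd)
    moreover have "closed {p::'a \<times> 'a. fst p - snd p \<in> B}"
      using continuous_closed_vimage[OF B(2), of "\<lambda>p. fst p - snd p"]
      by (simp add: vimage_def isCont_snd isCont_fst)
    ultimately show ?thesis by auto
  qed
  ultimately have "bounded_linear P" by (rule closed_graph)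
  then show ?thesis
    using that P unique by simp
qed

text \<open>Only the summand \<open>A\<close> is moved by \<open>L'\<close>; the complement stays
  the image of \<open>B\<close> under the fixed isomorphism \<open>L\<close>, with bounded inverse
  \<open>R\<close>. This is what lets one \<open>Es\<close> serve all nearby points.\<close>

lemma is_direct_sum_perturb:
  fixes L :: "'a::banach \<Rightarrow>\<^sub>L 'b::banach" and R :: "'b \<Rightarrow>\<^sub>L 'a"
  assumes ds: "is_direct_sum A B"
    and inv: "\<And>x. R (L x) = x" "\<And>y. L (R y) = y"
  obtains \<delta> where "\<delta> > 0"
    "\<And>L'. norm (L' - L) < \<delta> \<Longrightarrow> closed (blinfun_apply L' ` A) \<Longrightarrow>
       is_direct_sum (blinfun_apply L' ` A) (blinfun_apply L ` B)"
proof -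
  have A: "subspace A" and B: "subspace B" "closed B"
    using ds by (auto simp: is_direct_sum_def)
  obtain P0 where P0: "bounded_linear P0" "\<And>z. P0 z \<in> A" "\<And>z. z - P0 z \<in> B"
    "\<And>a b. a \<in> A \<Longrightarrow> b \<in> B \<Longrightarrow> P0 (a + b) = a"
    using is_direct_sum_projection[OF ds] by metis
  define P where "P = Blinfun P0"
  have P: "P z \<in> A" "z - P z \<in> B" "a \<in> A \<Longrightarrow> b \<in> B \<Longrightarrow> P (a + b) = a" for z a b
    using P0 by (simp_all add: P_def bounded_linear_Blinfun_apply)
  \<comment> \<open>Chosen so that \<open>norm R * norm P * \<delta> < 1\<close>, which makes
    \<open>K\<close> below a contraction; the summand 1 keeps the denominator positive.\<close>
  define \<delta> where "\<delta> = 1 / (norm R * norm P + 1)"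
  have \<delta>: "\<delta> > 0" by (simp add: \<delta>_def add_nonneg_pos)
  have "is_direct_sum (blinfun_apply L' ` A) (blinfun_apply L ` B)"
    if small: "norm (L' - L) < \<delta>" and cl: "closed (blinfun_apply L' ` A)" for L'
  proof -
    \<comment> \<open>\<open>L' \<circ> P + L \<circ> (id - P)\<close> maps \<open>A\<close> onto \<open>L' ` A\<close> and \<open>B\<close> onto \<open>L ` B\<close>, and it factors
      as \<open>L \<circ> (id - K)\<close> with a contraction \<open>K\<close>.\<close>
    define K where "K = R o\<^sub>L (L - L') o\<^sub>L P"
    have K: "K x = R (L (P x) - L' (P x))" for x
      by (simp add: K_def blinfun.diff_left)
    have "norm K \<le> norm R * norm (L - L') * norm P"
      unfolding K_def
      by (meson norm_blinfun_compose order_trans mult_right_mono norm_ge_zero)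
    also have "\<dots> \<le> norm R * norm P * \<delta>"
      using mult_left_mono[OF less_imp_le[OF small], of "norm R * norm P"]
      by (simp add: norm_minus_commute mult_ac)
    also have "\<dots> < 1"
      using add_nonneg_pos[of "norm R * norm P" 1] by (simp add: \<delta>_def divide_less_eq)
    finally have K1: "norm K < 1" .
    have key: "L (x - K x) = L' (P x) + L (x - P x)" for x
      by (simp add: K inv blinfun.diff_right)
    have "\<exists>a\<in>A. \<exists>b\<in>B. y = L' a + L b" for y
    proof -
      \<comment> \<open>Banach's fixed point theorem inverts \<open>id - K\<close>, so
        \<open>key\<close> decomposes every \<open>y\<close>.\<close>
      have "\<exists>!x. K x + R y = x"
        using K1 norm_blinfun[of K]
        by (intro banach_fix_type[of "norm K"]) (auto simp: dist_norm simp flip: blinfun.diff_right)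
      then obtain x where "x - K x = R y" by (metis add_diff_cancel_left')
      then have "y = L' (P x) + L (x - P x)" using key[of x] by (simp add: inv)
      then show ?thesis using P by blast
    qed
    then have "{a + b | a b. a \<in> blinfun_apply L' ` A \<and> b \<in> blinfun_apply L ` B} = UNIV"
      by blast
    \<comment> \<open>For \<open>x = a - b\<close> the right-hand side of \<open>key\<close> is
      \<open>L' a - L b = 0\<close>. Hence \<open>x = K x\<close>, and the contraction
      \<open>K\<close> fixes only 0.\<close>
    moreover have "L' a = 0" if "a \<in> A" "b \<in> B" "L' a = L b" for a b
    proof -
      have Pab: "P (a - b) = a"
        using P(3)[of a "- b"] that B by (simp add: subspace_neg)
      then have "L ((a - b) - K (a - b)) = 0"
        using that key[of "a - b"] by (simp add: blinfun.minus_right)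
      then have "(a - b) - K (a - b) = 0"
        by (metis inv(1) blinfun.zero_right)
      then have "norm (a - b) \<le> norm K * norm (a - b)"
        using norm_blinfun[of K "a - b"] by simp
      then have "a - b = 0"
        using K1 by (metis mult_le_cancel_right1 not_le norm_le_zero_iff)
      then show ?thesis using Pab by (metis blinfun.zero_right)
    qed
    moreover have "0 \<in> blinfun_apply L' ` A" "0 \<in> blinfun_apply L ` B"
      using A B by (metis blinfun.zero_right imageI subspace_0)+
    moreover have "closed (blinfun_apply L ` B)"
    proof -
      have "blinfun_apply L ` B = blinfun_apply R -` B"
        using inv by (auto simp: image_iff) metis
      then show ?thesis
        using B by (simp add: continuous_closed_vimage blinfun.isCont)
    qed
    moreover have "subspace (blinfun_apply L' ` A)" "subspace (blinfun_apply L ` B)"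
      using A B by (simp_all add: linear_subspace_image bounded_linear.linear blinfun.bounded_linear_right)
    ultimately show ?thesis
      unfolding is_direct_sum_def using cl by blast
  qed
  then show ?thesis using \<delta> that by metis
qed

section \<open>Tangent vectors in a chart\<close>

lemma has_vector_derivative_chain_at:
  assumes "(f has_vector_derivative f') (at t)" "(g has_derivative g') (at (f t))"
  shows "((\<lambda>s. g (f s)) has_vector_derivative g' f') (at t)"
  using vector_derivative_diff_chain_within[OF assms(1) has_derivative_at_withinI[OF assms(2)]]
  by (simp add: o_def)

text \<open>The difference quotients at \<open>t\<close> lie in \<open>A\<close>, and a closed set
  contains their limit.\<close>

lemma vector_derivative_in_closed_subspace:
  assumes der: "(f has_vector_derivative v) (at t)" and A: "subspace A" "closed A"
    and ev: "\<forall>\<^sub>F s in nhds t. f s \<in> A"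
  shows "v \<in> A"
proof -
  have "f t \<in> A" using ev by (rule eventually_nhds_x_imp_x)
  moreover have "\<forall>\<^sub>F s in at t. f s \<in> A" using ev by (simp add: eventually_at_filter eventually_mono)
  ultimately have "\<forall>\<^sub>F s in at t. (1 / (s - t)) *\<^sub>R (f s - f t) \<in> A"
    using A by (auto elim!: eventually_mono intro!: subspace_scale subspace_diff)
  moreover have "((\<lambda>s. (1 / (s - t)) *\<^sub>R (f s - f t)) \<longlongrightarrow> v) (at t)"
  proof (rule LIM_zero_cancel, rule tendsto_norm_zero_cancel)
    \<comment> \<open>The Frechet form divides by \<open>norm (s - t)\<close> instead of
      \<open>s - t\<close>; the two differ by a sign, which disappears under the norm.\<close>
    have "((\<lambda>s. (1 / norm (s - t)) *\<^sub>R (f s - (f t + (s - t) *\<^sub>R v))) \<longlongrightarrow> 0) (at t)"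
      using der by (simp add: has_vector_derivative_def has_derivative_within)
    moreover have "norm ((1 / norm (s - t)) *\<^sub>R (f s - (f t + (s - t) *\<^sub>R v))) =
        norm ((1 / (s - t)) *\<^sub>R (f s - f t) - v)" if "s \<noteq> t" for s
    proof -
      have "(1 / (s - t)) *\<^sub>R (f s - f t) - v = (1 / (s - t)) *\<^sub>R (f s - (f t + (s - t) *\<^sub>R v))"
        using that by (simp add: scaleR_diff_right scaleR_add_right)
      then show ?thesis by simp
    qed
    ultimately show "((\<lambda>s. norm ((1 / (s - t)) *\<^sub>R (f s - f t) - v)) \<longlongrightarrow> 0) (at t)"
      by (elim Lim_transform_eventually[OF tendsto_norm_zero])
        (auto simp: eventually_at_filter intro: always_eventually)
  qed
  ultimately show ?thesis
    using Lim_in_closed_set[OF A(2)] by fastforce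
qed

text \<open>A curve in \<open>S\<close> is pushed by \<open>\<phi>\<close> into \<open>E\<close>, so
  its velocity maps into \<open>E\<close>. Conversely, a vector of \<open>E\<close> is the velocity
  of a line segment, which the inverse chart pulls back to a curve in \<open>S\<close>.\<close>

lemma tangent_vectors_chart:
  assumes diffeo: "C1_diffeomorphism \<phi> U V"
    and E: "subspace E" "closed E" and ope: "openin (top_of_set E) (\<phi> ` (S \<inter> U))"
    and f': "\<And>x. x \<in> U \<Longrightarrow> (\<phi> has_derivative blinfun_apply (f' x)) (at x)"
    and g': "\<And>y. y \<in> V \<Longrightarrow> (inv_into U \<phi> has_derivative blinfun_apply (g' y)) (at y)"
    and g'_cont: "continuous_on V g'"
    and gf: "\<And>v. g' (\<phi> x) (f' x v) = v" and fg: "\<And>v. f' x (g' (\<phi> x) v) = v"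
    and x: "x \<in> S" "x \<in> U"
  shows "tangent_vectors S x = blinfun_apply (g' (\<phi> x)) ` E"
proof -
  let ?\<psi> = "inv_into U \<phi>"
  have U: "open U" and V: "open V" and bij: "bij_betw \<phi> U V"
    using diffeo by (auto simp: C1_diffeomorphism_def)
  have \<psi>: "?\<psi> (\<phi> z) = z" if "z \<in> U" for z
    using bij that by (simp add: bij_betw_inv_into_left)
  show ?thesis
  proof (intro equalityI subsetI)
    fix v assume "v \<in> tangent_vectors S x"
    then obtain e c where e: "e > 0" and cS: "\<forall>t\<in>{-e<..<e}. c t \<in> S" and c0: "c 0 = x"
      and c': "(c has_vector_derivative v) (at 0)"
      by (auto simp: tangent_vectors_def)
    \<comment> \<open>The filter \<open>nhds 0\<close> includes \<open>t = 0\<close> itself, as the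
      lemma on closed subspaces requires.\<close>
    have "(c \<longlongrightarrow> c 0) (nhds 0)"
      using has_vector_derivative_continuous[OF c'] by (simp add: tendsto_nhds_iff isCont_def)
    then have "\<forall>\<^sub>F t in nhds 0. c t \<in> U"
      using U x c0 by (simp add: topological_tendstoD)
    moreover have "\<forall>\<^sub>F t in nhds 0. t \<in> {-e<..<e}"
      using e by (intro eventually_nhds_in_open) auto
    ultimately have "\<forall>\<^sub>F t in nhds 0. \<phi> (c t) \<in> E"
    proof eventually_elim
      case (elim t)
      then show ?case using cS openin_subset[OF ope] by auto
    qed
    moreover have "((\<lambda>t. \<phi> (c t)) has_vector_derivative f' x v) (at 0)"
      using has_vector_derivative_chain_at[OF c'] f' x c0 by blast
    ultimately have "f' x v \<in> E"
      using vector_derivative_in_closed_subspace E by blast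
    then show "v \<in> blinfun_apply (g' (\<phi> x)) ` E"
      by (metis gf imageI)
  next
    fix v assume "v \<in> blinfun_apply (g' (\<phi> x)) ` E"
    then obtain w where w: "w \<in> E" "v = g' (\<phi> x) w" by blast
    obtain W where W: "open W" "\<phi> ` (S \<inter> U) = E \<inter> W"
      using ope by (metis openin_open)
    \<comment> \<open>The line stays in the subspace \<open>E\<close> for all \<open>t\<close> and
      in the open set \<open>W\<close> for small \<open>t\<close>, hence in the image of
      \<open>S \<inter> U\<close>.\<close>
    define l where "l t = \<phi> x + t *\<^sub>R w" for t :: real
    have l: "(l has_vector_derivative w) (at t)" for t
      unfolding l_def by (auto intro!: derivative_eq_intros)
    have l0: "l 0 = \<phi> x" by (simp add: l_def)
    have "continuous_on UNIV l" unfolding l_def by (intro continuous_intros)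
    then have "open (l -` W)" using W by (simp add: open_vimage)
    moreover have xE: "\<phi> x \<in> E \<inter> W" using W x by blast
    then have "0 \<in> l -` W" by (simp add: l0)
    ultimately obtain e where e: "e > 0" "ball 0 e \<subseteq> l -` W"
      using openE by blast
    have l_img: "l t \<in> \<phi> ` (S \<inter> U)" if "t \<in> {-e<..<e}" for t
    proof -
      have "l t \<in> W" using e that by (auto simp: subset_iff)
      moreover have "l t \<in> E" using xE w E by (simp add: l_def subspace_add subspace_scale)
      ultimately show ?thesis using W by blast
    qed
    then have lV: "l t \<in> V" if "t \<in> {-e<..<e}" for t
      using that bij by (fastforce simp: bij_betw_def)
    define c where "c t = ?\<psi> (l t)" for t
    have c': "(c has_vector_derivative g' (l t) w) (at t)" if "t \<in> {-e<..<e}" for t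
      unfolding c_def by (rule has_vector_derivative_chain_at[OF l g'[OF lV[OF that]]])
    have "continuous_on {-e<..<e} (\<lambda>t. g' (l t))"
      using lV by (intro continuous_on_compose2[OF g'_cont] 
          continuous_on_subset[OF \<open>continuous_on UNIV l\<close>]) auto
    then have "continuous_on {-e<..<e} (\<lambda>t. g' (l t) w)"
      by (intro continuous_intros)
    then have "c C1_differentiable_on {-e<..<e}"
      unfolding C1_differentiable_on_def using c' by (intro exI[of _ "\<lambda>t. g' (l t) w"]) simp
    moreover have "c t \<in> S" if "t \<in> {-e<..<e}" for t
    proof -
      obtain z where "z \<in> S" "z \<in> U" "l t = \<phi> z" using l_img \<open>t \<in> {-e<..<e}\<close> by blast
      then show ?thesis by (simp add: c_def \<psi>)
    qed
    moreover have "c 0 = x" using \<psi> x by (simp add: c_def l0)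
    moreover have "(c has_vector_derivative v) (at 0)"
      using c'[of 0] e w by (simp add: l0)
    ultimately show "v \<in> tangent_vectors S x"
      unfolding tangent_vectors_def using e by blast
  qed
qed

section \<open>Construction of the common complement and the neighborhood\<close>

theorem theorem2p1:
  fixes \<Lambda> :: "'a::banach set"
    and M :: "'a \<Rightarrow> 'a set"
    and x0 :: 'a
    and S :: "'a set"
  assumes "open \<Lambda>"
    and "\<forall>x\<in>\<Lambda>. subspace (M x)"
    and "x0 \<in> \<Lambda>"
    and "C1_integrable_at \<Lambda> M x0"
    and "integral_submanifold \<Lambda> M x0 S"
  shows "\<exists>Es U0. subspace Es \<and> closed Es \<and> open U0 \<and> x0 \<in> U0 \<and>
           (\<forall>x \<in> S \<inter> U0. is_direct_sum (M x) Es) \<and>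
           is_direct_sum (M x0) Es \<and> S \<inter> U0 \<subseteq> cofinal_set \<Lambda> M Es"
proof -
  have S: "S \<subseteq> \<Lambda>" "x0 \<in> S" and tan: "\<And>x. x \<in> S \<Longrightarrow> M x = tangent_vectors S x"
    and sub: "C1_submanifold S"
    using assms(5) by (auto simp: integral_submanifold_def tangent_at_def)
  from bspec[OF sub[unfolded C1_submanifold_def] S(2)]
  obtain E0 :: "'a set" and U and \<phi> :: "'a \<Rightarrow> 'a" where E0: "splits E0" and x0U: "x0 \<in> U"
    and diffeo: "C1_diffeomorphism \<phi> U (\<phi> ` U)"
    and ope: "openin (top_of_set E0) (\<phi> ` (S \<inter> U))"
    by blast
  obtain B where B: "is_direct_sum E0 B" and clE0: "subspace E0" "closed E0"
    using E0 by (auto simp: splits_def)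
  let ?\<psi> = "inv_into U \<phi>"
  have U: "open U" "open (\<phi> ` U)" and inj: "inj_on \<phi> U"
    using diffeo by (auto simp: C1_diffeomorphism_def bij_betw_def)
  obtain f' where f': "\<And>x. x \<in> U \<Longrightarrow> (\<phi> has_derivative blinfun_apply (f' x)) (at x)"
    using diffeo unfolding C1_diffeomorphism_def C1_map_on_def by meson
  obtain g' where g': "\<And>y. y \<in> \<phi> ` U \<Longrightarrow> (?\<psi> has_derivative blinfun_apply (g' y)) (at y)"
    and g'_cont: "continuous_on (\<phi> ` U) g'"
    using diffeo unfolding C1_diffeomorphism_def C1_map_on_def by meson
  \<comment> \<open>Both compositions of \<open>\<phi>\<close> and its inverse are the identity on
    open sets, so uniqueness of derivatives makes the two differentials mutually inverse.\<close>
  have gf: "g' (\<phi> x) (f' x v) = v" and fg: "f' x (g' (\<phi> x) v) = v" if x: "x \<in> U" for x v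
  proof -
    have \<psi>x: "?\<psi> (\<phi> x) = x" using inj x by simp
    have "((\<lambda>z. ?\<psi> (\<phi> z)) has_derivative (\<lambda>v. g' (\<phi> x) (f' x v))) (at x)"
      using has_derivative_compose[OF f' g'] x by blast
    moreover have "((\<lambda>z. ?\<psi> (\<phi> z)) has_derivative (\<lambda>v. v)) (at x)"
      using has_derivative_transform_within_open[OF has_derivative_ident U(1) x] inj by simp
    ultimately show "g' (\<phi> x) (f' x v) = v"
      using has_derivative_unique by metis
    have "((\<lambda>z. \<phi> (?\<psi> z)) has_derivative (\<lambda>v. f' x (g' (\<phi> x) v))) (at (\<phi> x))"
      using has_derivative_compose[OF g'[of "\<phi> x"], of \<phi> "f' x"] f' x \<psi>x by simp
    moreover have "((\<lambda>z. \<phi> (?\<psi> z)) has_derivative (\<lambda>v. v)) (at (\<phi> x))"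
      using has_derivative_transform_within_open[OF has_derivative_ident U(2), of "\<phi> x"] x
      by (simp add: f_inv_into_f)
    ultimately show "f' x (g' (\<phi> x) v) = v"
      using has_derivative_unique by metis
  qed
  have M: "M x = blinfun_apply (g' (\<phi> x)) ` E0" if "x \<in> S" "x \<in> U" for x
    using tangent_vectors_chart[OF diffeo clE0 ope f' g' g'_cont gf fg] tan that by blast
  obtain \<delta> where \<delta>: "\<delta> > 0" and perturb: "\<And>L'. norm (L' - g' (\<phi> x0)) < \<delta> \<Longrightarrow>
      closed (blinfun_apply L' ` E0) \<Longrightarrow>
      is_direct_sum (blinfun_apply L' ` E0) (blinfun_apply (g' (\<phi> x0)) ` B)"
    using is_direct_sum_perturb[OF B fg[OF x0U] gf[OF x0U]] by metis
  define Es where "Es = blinfun_apply (g' (\<phi> x0)) ` B"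
  \<comment> \<open>These are the points whose differential is within the tolerance
    \<open>\<delta>\<close> of the one at \<open>x0\<close>; \<open>U0\<close> is open because the
    inverse chart is C1.\<close>
  define U0 where "U0 = U \<inter> (\<lambda>x. g' (\<phi> x)) -` ball (g' (\<phi> x0)) \<delta>"
  have "continuous_on U \<phi>"
    using f' by (meson continuous_at_imp_continuous_on has_derivative_continuous)
  then have "continuous_on U (\<lambda>x. g' (\<phi> x))"
    by (intro continuous_on_compose2[OF g'_cont]) auto
  then have "open U0"
    unfolding U0_def using U(1) by (intro continuous_open_preimage) auto
  moreover have x0: "x0 \<in> U0" using x0U \<delta> by (simp add: U0_def)
  moreover have ds: "is_direct_sum (M x) Es" if x: "x \<in> S \<inter> U0" for x
  proof -
    have xU: "x \<in> U" and near: "norm (g' (\<phi> x) - g' (\<phi> x0)) < \<delta>"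
      using x by (auto simp: U0_def dist_norm norm_minus_commute)
    \<comment> \<open>An image under an invertible operator is a preimage under its bounded inverse,
      which yields the closedness that \<open>perturb\<close> asks for.\<close>
    have "blinfun_apply (g' (\<phi> x)) ` E0 = blinfun_apply (f' x) -` E0"
      using gf[OF xU] fg[OF xU] by (auto simp: image_iff) metis
    then have "closed (blinfun_apply (g' (\<phi> x)) ` E0)"
      using clE0 by (simp add: continuous_closed_vimage blinfun.isCont)
    then show ?thesis
      using perturb[OF near] M x xU by (simp add: Es_def)
  qed
  moreover have "is_direct_sum (M x0) Es" using ds S x0 by blast
  moreover from this have "subspace Es" "closed Es" by (simp_all add: is_direct_sum_def)
  moreover have "S \<inter> U0 \<subseteq> cofinal_set \<Lambda> M Es" using ds S by (auto simp: cofinal_set_def)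
  ultimately show ?thesis by blast
qed

end
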